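(* Let $p$ be a prime and let $f:\mathbb{F}_p\to[0,1]$ be a function that is not identically $0$. Put $\theta := p^{-1}\sum_{n\in\mathbb{F}_p} f(n)$ and, for $a\in\mathbb{F}_p$, $\hat f(a):=\sum_{n\in\mathbb{F}_p} f(n)e^{2\pi i an/p}$. Let $a_1,\dots,a_p$ be any ordering of the elements of $\mathbb{F}_p$ such that $|\hat f(a_1)|\ge\cdots\ge|\hat f(a_p)|$, and set $\lambda_i:=\hat f(a_i)$. Let $t\ge 3$ be an integer. Suppose that for some integer $k$ with $$1\le k<(\log p)^{t-1}(5t\log\log p)^{-2t+2}$$ we have $|\lambda_{k+1}|\le\gamma|\lambda_k|$, where $$\gamma< t^{-1}\theta^{-t+2}\bigl(|\lambda_k|/p\bigr)^{t-1}.$$ Then the $t$-fold convolution $f*f*\cdots*f$ ($t$ copies of $f$) is positive at every point of $\mathbb{F}_p$.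
   Context: Convolution on $\mathbb{F}_p$ is $(f*g)(n)=\sum_{m\in\mathbb{F}_p} f(m)g(n-m)$. Elements of $\mathbb{F}_p$ are identified with residues $0,\dots,p-1$ in the exponentials. $\log$ denotes the natural logarithm. *)

theory Defs
  imports Complex_Main "Berlekamp_Zassenhaus.Finite_Field"
begin

text \<open>The field with p elements is \<^typ>\<open>'p mod_ring\<close> for a type \<open>'p\<close> of class
  \<^class>\<open>prime_card\<close>, with p the cardinality of \<open>'p\<close>; the function
  \<^const>\<open>to_int_mod_ring\<close> returns the representative of a residue class in 0, ..., p - 1.\<close>

definition conv ::
    "('p::prime_card mod_ring \<Rightarrow> real) \<Rightarrow> ('p mod_ring \<Rightarrow> real) \<Rightarrow> 'p mod_ring \<Rightarrow> real" where
  "conv f g n = (\<Sum>m\<in>UNIV. f m * g (n - m))"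

text \<open>For t \<open>\<ge>\<close> 1 the following function is the convolution of t copies of f. At t = 0 it takes
  the value f, which has no meaning.\<close>

definition conv_power ::
    "nat \<Rightarrow> ('p::prime_card mod_ring \<Rightarrow> real) \<Rightarrow> 'p mod_ring \<Rightarrow> real" where
  "conv_power t f = (conv f ^^ (t - 1)) f"

definition fourier :: "('p::prime_card mod_ring \<Rightarrow> real) \<Rightarrow> 'p mod_ring \<Rightarrow> complex" where
  "fourier f a = (\<Sum>n\<in>UNIV. complex_of_real (f n) *
     exp (2 * complex_of_real pi * \<i> * of_int (to_int_mod_ring a * to_int_mod_ring n)
          / of_nat CARD('p)))"

definition density :: "('p::prime_card mod_ring \<Rightarrow> real) \<Rightarrow> real" where
  "density f = (\<Sum>n\<in>UNIV. f n) / real CARD('p)"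

end

theory Submission
  imports Defs "HOL-Analysis.Harmonic_Numbers"
begin

text \<open>If the convolution power vanishes at n, then so does, for all shifts d 0, ..., d (t - 1),
  the convolution of the twists of f by the characters d i. Hence the products over i of
  \<open>fourier f (c + d i)\<close>, weighted by the character \<open>- c\<close> at n, sum to 0 over c. Let A be the set
  of the k largest frequencies. If exactly one c has all \<open>c + d i\<close> in A, then its term has size at
  least \<open>\<bar>lam k\<bar> ^ t\<close>, whereas every other term has a factor of size at most \<open>\<bar>lam (k + 1)\<bar>\<close>; by
  Parseval the other terms are too small to cancel it.

  The shifts are found one at a time. Each divides the size of the intersection C of translates
  of A by \<open>R = ln p / (5 t ln ln p)\<^sup>2\<close>, until a single point is left. If every nonempty
  intersection of C with a translate of A were larger than that, some small subset B of C would
  meet each of them at least twice. But a dilation puts B in a short interval, while the dilate of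
  A has an element preceded by a long gap; the translate of A that moves this element to the
  maximum of B meets B only once.\<close>

section \<open>Gaps, dilations and intersections of translates\<close>

text \<open>If each element of \<open>A\<close> had another one at most \<open>W\<close> steps below
  it, the points \<open>a + i\<close> with \<open>i < W\<close> would form a set closed under
  subtracting 1. Such a set is the whole field, yet it has at most \<open>card A * W\<close>
  points.\<close>

lemma exists_gap_below:
  fixes A :: "'p::prime_card mod_ring set"
  assumes "A \<noteq> {}" and "card A * W < CARD('p)"
  shows "\<exists>a\<in>A. \<forall>i\<in>{1..W}. a - of_nat i \<notin> A"
proof (rule ccontr)
  assume no_gap: "\<not> ?thesis"
  define S where "S = (\<lambda>(a, i). a + of_nat i) ` (A \<times> {..<W})"
  obtain a0 where a0: "a0 \<in> A" using assms(1) by blast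
  have "0 < W" using no_gap a0 by force
  have pred: "x - 1 \<in> S" if x: "x \<in> S" for x
  proof -
    obtain a i where ai: "a \<in> A" "i < W" "x = a + of_nat i"
      using x unfolding S_def by auto
    show ?thesis
    proof (cases i)
      case 0
      obtain j where j: "j \<in> {1..W}" "a - of_nat j \<in> A" using no_gap ai(1) by blast
      have "x - 1 = (a - of_nat j) + of_nat (j - 1)"
        using j(1) ai(3) 0 by (simp add: of_nat_diff)
      then show ?thesis
        using j unfolding S_def by (intro image_eqI[where x = "(a - of_nat j, j - 1)"]) auto
    next
      case (Suc j)
      then show ?thesis
        using ai unfolding S_def by (intro image_eqI[where x = "(a, j)"]) auto
    qed
  qed
  have a0S: "a0 - of_nat n \<in> S" for n
  proof (induction n)
    case 0
    show ?case
      using a0 \<open>0 < W\<close> unfolding S_def by (intro image_eqI[where x = "(a0, 0)"]) auto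
  next
    case (Suc n)
    then show ?case using pred[OF Suc] by (simp add: algebra_simps)
  qed
  have "x \<in> S" for x
  proof -
    obtain n where "a0 - x = of_nat n" using surj_of_nat_mod_ring by blast
    then have "x = a0 - of_nat n" by (simp add: algebra_simps)
    then show ?thesis using a0S by simp
  qed
  then have "S = UNIV" by blast
  then have "CARD('p) = card S" by simp
  also have "\<dots> \<le> card (A \<times> {..<W})" unfolding S_def by (rule card_image_le) auto
  also have "\<dots> = card A * W" by (simp add: card_cartesian_product)
  finally show False using assms(2) by simp
qed

text \<open>Pigeonhole over the p multipliers: \<open>box J\<close> records, for each
  \<open>b\<close> in \<open>B\<close>, which of \<open>N\<close> equal parts of [0, p) contains the
  residue of \<open>J * b\<close>. Two multipliers share all their parts, and their difference moves
  every \<open>b\<close> to within p / N of 0.\<close>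

lemma dirichlet_dilation:
  fixes B :: "'p::prime_card mod_ring set" and N :: nat
  assumes N: "0 < N" and small: "N ^ card B < CARD('p)"
  shows "\<exists>J \<beta>. J \<noteq> 0 \<and> (\<forall>b\<in>B. of_int (\<beta> b) = J * b \<and> int N * \<bar>\<beta> b\<bar> < int CARD('p))"
proof -
  let ?p = "int CARD('p)"
  define box where
    "box J = restrict (\<lambda>b. int N * to_int_mod_ring (J * b) div ?p) B" for J :: "'p mod_ring"
  have rng: "0 \<le> to_int_mod_ring x \<and> to_int_mod_ring x < ?p" for x :: "'p mod_ring"
    using range_to_int_mod_ring[where ?'a = 'p] by (metis UNIV_I atLeastLessThan_iff image_eqI)
  have p0: "0 < ?p" by simp
  have "box J \<in> B \<rightarrow>\<^sub>E {0..<int N}" for J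
  proof -
    have "int N * to_int_mod_ring (J * b) div ?p < int N" for b
    proof -
      have "int N * to_int_mod_ring (J * b) < int N * ?p"
        using N rng by (intro mult_strict_left_mono) auto
      moreover have "int N * to_int_mod_ring (J * b) div ?p * ?p \<le> int N * to_int_mod_ring (J * b)"
        using p0 by (simp add: minus_mod_eq_div_mult[symmetric])
      ultimately have "int N * to_int_mod_ring (J * b) div ?p * ?p < int N * ?p" by linarith
      then show ?thesis by (simp only: mult_less_cancel_right_pos[OF p0])
    qed
    moreover have "0 \<le> int N * to_int_mod_ring (J * b) div ?p" for b
      using rng by (simp add: pos_imp_zdiv_nonneg_iff)
    ultimately show ?thesis unfolding box_def by auto
  qed
  then have "card (range box) \<le> card (B \<rightarrow>\<^sub>E {0..<int N})"
    by (intro card_mono finite_PiE) auto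
  also have "\<dots> = N ^ card B" by (simp add: card_PiE)
  finally have "card (range box) < CARD('p mod_ring)" using small by simp
  then have "\<not> inj box" using card_image by fastforce
  then obtain J1 J2 where J: "box J1 = box J2" "J1 \<noteq> J2" by (auto simp: inj_def)
  define \<beta> where "\<beta> b = to_int_mod_ring (J1 * b) - to_int_mod_ring (J2 * b)" for b
  have "of_int (\<beta> b) = (J1 - J2) * b" for b
  proof -
    have "of_int (to_int_mod_ring x) = x" for x :: "'p mod_ring"
      by (simp add: of_int_of_int_mod_ring)
    then show ?thesis unfolding \<beta>_def by (simp add: left_diff_distrib)
  qed
  moreover have "int N * \<bar>\<beta> b\<bar> < ?p" if "b \<in> B" for b
  proof -
    let ?u = "int N * to_int_mod_ring (J1 * b)" and ?v = "int N * to_int_mod_ring (J2 * b)"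
    have "?u div ?p = ?v div ?p" using fun_cong[OF J(1), of b] that unfolding box_def by simp
    moreover have "?u = ?u div ?p * ?p + ?u mod ?p" "?v = ?v div ?p * ?p + ?v mod ?p" by simp_all
    ultimately have "?u - ?v = ?u mod ?p - ?v mod ?p" by (metis add_diff_cancel_left)
    moreover have "0 \<le> ?u mod ?p" "?u mod ?p < ?p" "0 \<le> ?v mod ?p" "?v mod ?p < ?p"
      using p0 by simp_all
    ultimately have "\<bar>?u - ?v\<bar> < ?p" by linarith
    then show ?thesis unfolding \<beta>_def by (simp add: right_diff_distrib[symmetric] abs_mult)
  qed
  ultimately show ?thesis using J(2) by (intro exI[of _ "J1 - J2"] exI[of _ \<beta>]) auto
qed

text \<open>The points are chosen greedily: by averaging, some point of \<open>C\<close> lies in at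
  least a fraction 1 / r of the sets not yet hit, so adding it to \<open>B\<close> multiplies their
  number by at most 1 - 1 / r.\<close>

lemma greedy_hitting:
  fixes C :: "'a set" and F :: "'a set set" and r :: real
  assumes "finite C" "C \<noteq> {}" "finite F" "1 \<le> r"
    and F: "\<And>S. S \<in> F \<Longrightarrow> S \<subseteq> C \<and> real (card C) \<le> r * real (card S)"
  shows "\<exists>B\<subseteq>C. card B \<le> n \<and> real (card {S \<in> F. S \<inter> B = {}}) \<le> real (card F) * (1 - 1 / r) ^ n"
proof (induction n)
  case 0
  show ?case by (intro exI[of _ "{}"]) auto
next
  case (Suc n)
  then obtain B where B: "B \<subseteq> C" "card B \<le> n"
    "real (card {S \<in> F. S \<inter> B = {}}) \<le> real (card F) * (1 - 1 / r) ^ n" by blast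
  define U where "U = {S \<in> F. S \<inter> B = {}}"
  have "finite U" using assms(3) unfolding U_def by simp
  have "\<exists>c\<in>C. real (card U) \<le> r * real (card {S \<in> U. c \<in> S})"
  proof (rule ccontr)
    assume "\<not> ?thesis"
    then have lt: "r * real (card {S \<in> U. c \<in> S}) < real (card U)" if "c \<in> C" for c
      using that by force
    \<comment> \<open>The incidences between points of \<open>C\<close> and sets in \<open>U\<close>
      are counted in two ways.\<close>
    have "real (card C) * real (card U) \<le> (\<Sum>S\<in>U. r * real (card S))"
      using F sum_mono[of U "\<lambda>_. real (card C)" "\<lambda>S. r * real (card S)"] unfolding U_def
      by (simp add: mult.commute)
    also have "\<dots> = r * real (\<Sum>S\<in>U. card {c \<in> C. c \<in> S})"
    proof -
      have "{c \<in> C. c \<in> S} = S" if "S \<in> U" for S using F that unfolding U_def by blast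
      then show ?thesis by (simp add: sum_distrib_left)
    qed
    also have "(\<Sum>S\<in>U. card {c \<in> C. c \<in> S}) = (\<Sum>c\<in>C. card {S \<in> U. c \<in> S})"
      using sum_multicount_gen[of U C "\<lambda>S c. c \<in> S" "\<lambda>c. card {S \<in> U. c \<in> S}"]
        \<open>finite U\<close> assms(1) by simp
    also have "r * real \<dots> = (\<Sum>c\<in>C. r * real (card {S \<in> U. c \<in> S}))"
      by (simp add: sum_distrib_left)
    also have "\<dots> < (\<Sum>c\<in>C. real (card U))"
      using assms lt by (intro sum_strict_mono) auto
    finally show False by simp
  qed
  then obtain c where c: "c \<in> C" "real (card U) \<le> r * real (card {S \<in> U. c \<in> S})" by blast
  have eq: "{S \<in> F. S \<inter> insert c B = {}} = U - {S \<in> U. c \<in> S}" unfolding U_def by auto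
  have "card (U - {S \<in> U. c \<in> S}) = card U - card {S \<in> U. c \<in> S}"
    using \<open>finite U\<close> by (intro card_Diff_subset) auto
  moreover have "card {S \<in> U. c \<in> S} \<le> card U" using \<open>finite U\<close> by (intro card_mono) auto
  ultimately have "real (card (U - {S \<in> U. c \<in> S})) = real (card U) - real (card {S \<in> U. c \<in> S})"
    by simp
  also have "\<dots> \<le> real (card U) - real (card U) / r"
    using c(2) assms(4) by (simp add: field_simps)
  also have "\<dots> = real (card U) * (1 - 1 / r)" by (simp add: algebra_simps)
  also have "\<dots> \<le> real (card F) * (1 - 1 / r) ^ n * (1 - 1 / r)"
    using B(3) assms(4) unfolding U_def by (intro mult_right_mono) auto
  finally have "real (card {S \<in> F. S \<inter> insert c B = {}}) \<le> real (card F) * (1 - 1 / r) ^ Suc n"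
    unfolding eq by (simp add: mult_ac)
  moreover have "card (insert c B) \<le> Suc n" using B(2)
    by (simp add: le_SucI card_insert_if finite_subset[OF B(1) assms(1)])
  ultimately show ?case using B(1) c(1) by (intro exI[of _ "insert c B"]) auto
qed

text \<open>A one-point intersection already ends the descent, whence the \<open>max 1\<close>; if
  the claim fails, every nonempty intersection has at least two points. The hypothesis
  \<open>small\<close> is the pigeonhole condition for a hitting set of \<open>m\<close> points with
  \<open>2 * k\<close> parts: it confines the dilated set to an interval shorter than p / k, and the
  dilate of \<open>A\<close> has a gap of that order.\<close>

lemma small_translate_inter:
  fixes A C :: "'p::prime_card mod_ring set" and r :: real and k :: nat
  assumes ne: "A \<noteq> {}" "C \<noteq> {}" and kA: "card A \<le> k" and kC: "card C \<le> k" and r: "1 \<le> r"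
    and small: "\<And>m. real m \<le> 6 * r * ln (real k) + 1 \<Longrightarrow> (2 * k) ^ m < CARD('p)"
  shows "\<exists>d. {c \<in> C. c - d \<in> A} \<noteq> {} \<and>
    real (card {c \<in> C. c - d \<in> A}) \<le> max 1 (real (card C) / r)"
proof (rule ccontr)
  assume neg: "\<not> ?thesis"
  define S where "S d = {c \<in> C. c - d \<in> A}" for d
  have big: "max 1 (real (card C) / r) < real (card (S d))" if "S d \<noteq> {}" for d
    using neg that unfolding S_def by force
  have "0 < card A" using ne(1) by (simp add: card_gt_0_iff)
  then have k: "1 \<le> k" using kA by linarith
  \<comment> \<open>Deleting an arbitrary point from each set turns hitting once into hitting twice.\<close>
  define F where "F = (\<lambda>(c, a, x). S (c - a) - {x}) ` (C \<times> A \<times> C)"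
  have "card F \<le> card (C \<times> A \<times> C)" unfolding F_def by (rule card_image_le) auto
  also have "\<dots> \<le> k * (k * k)"
    unfolding card_cartesian_product using kA kC by (intro mult_mono) auto
  finally have cF: "real (card F) \<le> real k ^ 3"
    by (metis of_nat_le_iff of_nat_mult power3_eq_cube mult.assoc)
  \<comment> \<open>Removing one point from a set with at least two leaves at least half of it, so
    the proportion 1 / r drops to no less than 1 / (2 * r).\<close>
  have FC: "T \<subseteq> C \<and> real (card C) \<le> (2 * r) * real (card T)" if TF: "T \<in> F" for T
  proof -
    obtain c a x where T: "c \<in> C" "a \<in> A" "T = S (c - a) - {x}"
      using TF unfolding F_def by auto
    have "S (c - a) \<noteq> {}" using T unfolding S_def by auto
    from big[OF this] have b: "1 < card (S (c - a))" "real (card C) < r * real (card (S (c - a)))"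
      using r by (auto simp: field_simps)
    have "card (S (c - a)) - 1 \<le> card T" unfolding T by (simp add: diff_card_le_card_Diff card_Diff_singleton_if)
    then have "real (card (S (c - a))) \<le> 2 * real (card T)" using b(1) by linarith
    then have "r * real (card (S (c - a))) \<le> r * (2 * real (card T))"
      using r by (intro mult_left_mono) auto
    then show ?thesis using b(2) T(3) unfolding S_def by auto
  qed
  \<comment> \<open>The factor 6 is 2 * 3: the decay rate is 1 / (2 * r), and the at most k ^ 3 sets
    of \<open>F\<close> must be reduced to fewer than one. The added 1 keeps the inequality strict,
    also for k = 1.\<close>
  define m where "m = nat \<lfloor>6 * r * ln (real k)\<rfloor> + 1"
  have lnk: "0 \<le> ln (real k)" using k by simp
  have m: "real m \<le> 6 * r * ln (real k) + 1" "6 * r * ln (real k) < real m"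
    using lnk r unfolding m_def by (auto simp: of_nat_nat) linarith+
  obtain B where B: "B \<subseteq> C" "card B \<le> m"
    "real (card {T \<in> F. T \<inter> B = {}}) \<le> real (card F) * (1 - 1 / (2 * r)) ^ m"
    using greedy_hitting[of C F "2 * r" m] FC ne r by (auto simp: F_def)
  have "(1 - 1 / (2 * r)) ^ m \<le> exp (- 1 / (2 * r)) ^ m"
    using r exp_ge_add_one_self[of "- 1 / (2 * r)"] by (intro power_mono) auto
  also have "\<dots> = exp (- (real m / (2 * r)))" by (simp add: exp_of_nat_mult[symmetric])
  also have "\<dots> < exp (- (3 * ln (real k)))" using m(2) r by (simp add: field_simps)
  also have "\<dots> = 1 / real k ^ 3"
    using k by (simp add: exp_minus exp_of_nat_mult[of 3, simplified] inverse_eq_divide)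
  finally have strict: "(1 - 1 / (2 * r)) ^ m < 1 / real k ^ 3" .
  have "F \<noteq> {}" using ne unfolding F_def by auto
  then have "0 < card F" by (simp add: card_gt_0_iff F_def)
  then have "real (card F) * (1 - 1 / (2 * r)) ^ m < real (card F) * (1 / real k ^ 3)"
    using strict by (intro mult_strict_left_mono) auto
  also have "\<dots> \<le> 1" using cF k by (simp add: field_simps)
  finally have "card {T \<in> F. T \<inter> B = {}} = 0" using B(3) by linarith
  then have hit: "T \<inter> B \<noteq> {}" if "T \<in> F" for T using that by (auto simp: F_def)
  have "B \<noteq> {}" using hit \<open>F \<noteq> {}\<close> by blast
  have "(2 * k) ^ card B \<le> (2 * k) ^ m" using B(2) k by (intro power_increasing) auto
  then have "(2 * k) ^ card B < CARD('p)" using small[OF m(1)] by linarith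
  then obtain J \<beta> where J: "J \<noteq> 0" and
    \<beta>: "\<And>b. b \<in> B \<Longrightarrow> of_int (\<beta> b) = J * b \<and> int (2 * k) * \<bar>\<beta> b\<bar> < int CARD('p)"
    using dirichlet_dilation[of "2 * k" B] k by auto
  \<comment> \<open>The largest gap length with \<open>k * W < CARD('p)\<close>.\<close>
  define W where "W = (CARD('p) - 1) div k"
  have "card ((*) J ` A) * W \<le> k * W"
    using kA card_image_le[of A "(*) J"] by (intro mult_right_mono) auto
  also have "\<dots> \<le> CARD('p) - 1" unfolding W_def by simp
  also have "\<dots> < CARD('p)" by simp
  finally have "\<exists>a\<in>(*) J ` A. \<forall>i\<in>{1..W}. a - of_nat i \<notin> (*) J ` A"
    using ne by (intro exists_gap_below) auto
  then obtain a1 where a1: "a1 \<in> A" "\<And>i. i \<in> {1..W} \<Longrightarrow> J * a1 - of_nat i \<notin> (*) J ` A"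
    by blast
  obtain b1 where b1: "b1 \<in> B" "\<And>b. b \<in> B \<Longrightarrow> \<beta> b \<le> \<beta> b1"
    using \<open>B \<noteq> {}\<close> obtains_MAX[of B \<beta>] by (metis finite Max_ge finite_imageI imageI)
  \<comment> \<open>The shift \<open>b1 - a1\<close> moves \<open>a1\<close> to \<open>b1\<close>.
    As \<open>b1\<close> itself is deleted, the hitting property yields a second point
    \<open>b\<close>; its dilate lies \<open>i\<close> steps below that of \<open>b1\<close>, with
    \<open>i\<close> in \<open>{1..W}\<close>, so moving back puts a point into the gap below
    \<open>J * a1\<close>.\<close>
  have "S (b1 - a1) - {b1} \<in> F"
    using a1(1) b1(1) B(1) unfolding F_def by (intro image_eqI[where x = "(b1, a1, b1)"]) auto
  from hit[OF this] obtain b where b: "b \<in> B" "b \<noteq> b1" "b - (b1 - a1) \<in> A"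
    unfolding S_def by auto
  define i where "i = nat (\<beta> b1 - \<beta> b)"
  have "J * b \<noteq> J * b1" using J b(2) by simp
  then have "\<beta> b \<noteq> \<beta> b1" using \<beta> b(1) b1(1) by metis
  then have i: "1 \<le> i" "int i = \<beta> b1 - \<beta> b" using b1(2)[OF b(1)] unfolding i_def by auto
  have "int (2 * k) * int i \<le> int (2 * k) * (\<bar>\<beta> b1\<bar> + \<bar>\<beta> b\<bar>)"
    unfolding i(2) by (intro mult_left_mono) auto
  also have "\<dots> < 2 * int CARD('p)"
    using \<beta>[OF b(1)] \<beta>[OF b1(1)] by (simp add: distrib_left)
  finally have "int (k * i) < int CARD('p)" by simp
  then have "i * k \<le> CARD('p) - 1" by (simp only: of_nat_less_iff) (simp add: mult.commute)
  then have "i \<in> {1..W}" using i(1) k unfolding W_def by (simp add: less_eq_div_iff_mult_less_eq)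
  have "of_nat i = (of_int (int i) :: 'p mod_ring)" by simp
  also have "\<dots> = J * b1 - J * b" unfolding i(2) using \<beta> b(1) b1(1) by simp
  finally have "J * a1 - of_nat i = J * (b - (b1 - a1))" by (simp add: algebra_simps)
  then have "J * a1 - of_nat i \<in> (*) J ` A" using b(3) by blast
  with a1(2)[OF \<open>i \<in> {1..W}\<close>] show False by blast
qed

text \<open>Each further shift divides the bound on the intersection by \<open>r\<close>, unless a
  single point is left. After \<open>s\<close> steps the bound is 1, and nonemptiness has been kept
  throughout; the initial translate makes \<open>s + 1\<close> shifts in all.\<close>

lemma unique_translate_inter:
  fixes A :: "'p::prime_card mod_ring set" and r :: real and k s :: nat
  assumes ne: "A \<noteq> {}" and kA: "card A \<le> k" and r: "1 \<le> r"
    and small: "\<And>m. real m \<le> 6 * r * ln (real k) + 1 \<Longrightarrow> (2 * k) ^ m < CARD('p)"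
    and k: "real k < r ^ s"
  shows "\<exists>d c0. \<forall>c. (\<forall>i\<le>s. c + d i \<in> A) \<longleftrightarrow> c = c0"
proof -
  have step: "\<exists>d. {c. \<forall>i\<le>j. c + d i \<in> A} \<noteq> {} \<and>
    real (card {c. \<forall>i\<le>j. c + d i \<in> A}) \<le> max 1 (real k / r ^ j)" for j
  proof (induction j)
    case 0
    show ?case using ne kA by (intro exI[of _ "\<lambda>_. 0"]) auto
  next
    case (Suc j)
    then obtain d where d: "{c. \<forall>i\<le>j. c + d i \<in> A} \<noteq> {}"
      "real (card {c. \<forall>i\<le>j. c + d i \<in> A}) \<le> max 1 (real k / r ^ j)" by blast
    define C where "C = {c. \<forall>i\<le>j. c + d i \<in> A}"
    \<comment> \<open>The shift of index 0 alone bounds the size of \<open>C\<close> by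
      \<open>k\<close>, as the next intersection step requires.\<close>
    have "C \<subseteq> (\<lambda>a. a - d 0) ` A" unfolding C_def by (force intro: image_eqI[where x = "c + d 0" for c])
    then have "card C \<le> k" using kA card_image_le[of A "\<lambda>a. a - d 0"] card_mono[of "(\<lambda>a. a - d 0) ` A" C]
      by simp
    then obtain e where e: "{c \<in> C. c - e \<in> A} \<noteq> {}"
      "real (card {c \<in> C. c - e \<in> A}) \<le> max 1 (real (card C) / r)"
      using small_translate_inter[of A C k r] ne kA r small d(1) unfolding C_def by blast
    have "real (card C) / r \<le> max 1 (real k / r ^ j) / r"
      using d(2) r unfolding C_def by (intro divide_right_mono) auto
    also have "\<dots> \<le> max 1 (real k / r ^ Suc j)"
    proof -
      have "1 / r \<le> 1" using r by simp
      moreover have "real k / r ^ j / r = real k / r ^ Suc j" by (simp add: mult.commute)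
      ultimately show ?thesis by (simp add: max_def mult.commute)
    qed
    finally have "real (card {c \<in> C. c - e \<in> A}) \<le> max 1 (real k / r ^ Suc j)"
      using e(2) by auto
    moreover have "{c. \<forall>i\<le>Suc j. c + (d(Suc j := - e)) i \<in> A} = {c \<in> C. c - e \<in> A}"
      unfolding C_def by (auto simp: le_Suc_eq)
    ultimately show ?case using e(1) by (intro exI[of _ "d(Suc j := - e)"]) simp
  qed
  obtain d where d: "{c. \<forall>i\<le>s. c + d i \<in> A} \<noteq> {}"
      "real (card {c. \<forall>i\<le>s. c + d i \<in> A}) \<le> max 1 (real k / r ^ s)" using step by blast
  have "real k / r ^ s \<le> 1" using k r by simp
  then have "card {c. \<forall>i\<le>s. c + d i \<in> A} \<le> 1" using d(2) by simp
  moreover have "0 < card {c. \<forall>i\<le>s. c + d i \<in> A}" using d(1) by (simp add: card_gt_0_iff)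
  ultimately have "card {c. \<forall>i\<le>s. c + d i \<in> A} = 1" by linarith
  then obtain c0 where "{c. \<forall>i\<le>s. c + d i \<in> A} = {c0}" by (auto simp: card_1_singleton_iff)
  then show ?thesis by (intro exI[of _ d] exI[of _ c0]) blast
qed

section \<open>Additive characters and Fourier analysis modulo p\<close>

lemma of_int_to_int_mod_ring [simp]: "of_int (to_int_mod_ring x) = (x :: 'p::nontriv mod_ring)"
  by (simp add: of_int_of_int_mod_ring)

definition additive_char :: "'p::prime_card mod_ring \<Rightarrow> complex" where
  "additive_char x = cis (2 * pi * of_int (to_int_mod_ring x) / real CARD('p))"

text \<open>Multiples of p contribute full turns, so any integer representative gives the same
  value. This yields additivity, and it lets the integer product in \<open>fourier\<close> be read
  as a product in the field.\<close>

lemma cis_eq_additive_char: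
  "cis (2 * pi * of_int z / real CARD('p)) = additive_char (of_int z :: 'p::prime_card mod_ring)"
proof -
  let ?p = "int CARD('p)"
  have "to_int_mod_ring (of_int z :: 'p mod_ring) = z mod ?p"
    unfolding of_int_of_int_mod_ring by transfer simp
  moreover have "real_of_int z = real_of_int (z div ?p) * real CARD('p) + real_of_int (z mod ?p)"
    by (metis div_mult_mod_eq of_int_add of_int_mult of_int_of_nat_eq)
  then have "2 * pi * of_int z / real CARD('p)
      = 2 * pi * of_int (z div ?p) + 2 * pi * of_int (z mod ?p) / real CARD('p)"
    by (simp add: field_simps)
  ultimately show ?thesis
    unfolding additive_char_def by (simp add: cis_mult[symmetric] cis_multiple_2pi)
qed

lemma additive_char_add: "additive_char (x + y) = additive_char x * additive_char y"
  for x y :: "'p::prime_card mod_ring"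
proof -
  have "additive_char x * additive_char y
      = cis (2 * pi * of_int (to_int_mod_ring x + to_int_mod_ring y) / real CARD('p))"
    unfolding additive_char_def cis_mult by (simp add: field_simps)
  also have "\<dots> = additive_char (x + y)"
    unfolding cis_eq_additive_char by simp
  finally show ?thesis ..
qed

lemma additive_char_0 [simp]: "additive_char 0 = 1"
  by (simp add: additive_char_def)

lemma norm_additive_char [simp]: "cmod (additive_char x) = 1"
  by (simp add: additive_char_def)

lemma cnj_additive_char: "cnj (additive_char x) = additive_char (- x)"
proof -
  have "additive_char x * additive_char (- x) = 1"
    by (simp flip: additive_char_add)
  moreover have "additive_char x * cnj (additive_char x) = 1"
    by (simp add: complex_norm_square[symmetric])
  moreover have "additive_char x \<noteq> 0"
    by (metis norm_additive_char norm_zero zero_neq_one)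
  ultimately show ?thesis by (metis mult_left_cancel)
qed

lemma additive_char_1_neq: "additive_char (1 :: 'p::prime_card mod_ring) \<noteq> 1"
proof
  assume "additive_char (1 :: 'p mod_ring) = 1"
  then have "cos (2 * pi / real CARD('p)) = 1"
    unfolding additive_char_def by (simp add: complex_eq_iff)
  then obtain n :: int where "2 * pi / real CARD('p) = real_of_int n * (2 * pi)"
    unfolding cos_one_2pi_int by (auto simp: mult.assoc)
  then have "2 * pi * (real_of_int n * real CARD('p) - 1) = 0" by (simp add: field_simps)
  then have "real_of_int n * real CARD('p) = 1" by (simp only: mult_eq_0_iff) simp
  then have "n * int CARD('p) = 1" by (metis of_int_eq_1_iff of_int_mult of_int_of_nat_eq)
  then have "CARD('p) = 1" by (simp add: zmult_eq_1_iff)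
  then show False using nontriv[where ?'a = 'p] by simp
qed

text \<open>For nonzero \<open>a\<close>, the substitution of \<open>x + inverse a\<close> for
  \<open>x\<close> multiplies the sum by \<open>additive_char 1\<close>, which is not 1; hence the
  sum is 0.\<close>

lemma sum_additive_char:
  fixes a :: "'p::prime_card mod_ring"
  shows "(\<Sum>x\<in>UNIV. additive_char (a * x)) = (if a = 0 then of_nat CARD('p) else 0)"
proof (cases "a = 0")
  case False
  have "(\<Sum>x\<in>UNIV. additive_char (a * x)) = (\<Sum>x\<in>UNIV. additive_char (a * (x + inverse a)))"
    by (rule sum.reindex_bij_witness[of _ "\<lambda>x. x + inverse a" "\<lambda>x. x - inverse a"]) auto
  also have "\<dots> = (\<Sum>x\<in>UNIV. additive_char (a * x)) * additive_char (1 :: 'p mod_ring)"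
    using False by (simp add: distrib_left additive_char_add sum_distrib_right)
  finally show ?thesis using additive_char_1_neq[where ?'p = 'p] False by simp
qed simp

lemma fourier_eq_sum_additive_char:
  "fourier f a = (\<Sum>n\<in>UNIV. complex_of_real (f n) * additive_char (a * n))"
proof -
  have "exp (2 * complex_of_real pi * \<i> * of_int (to_int_mod_ring a * to_int_mod_ring n)
      / of_nat CARD('a)) = additive_char (a * n)" for n
  proof -
    have "exp (2 * complex_of_real pi * \<i> * of_int (to_int_mod_ring a * to_int_mod_ring n)
        / of_nat CARD('a))
      = cis (2 * pi * of_int (to_int_mod_ring a * to_int_mod_ring n) / real CARD('a))"
      unfolding cis_conv_exp by (simp add: mult_ac)
    then show ?thesis
      unfolding cis_eq_additive_char by simp
  qed
  then show ?thesis unfolding fourier_def by simp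
qed

text \<open>Orthogonality of characters after exchanging the sums. \<open>G\<close> is
  complex-valued because twisted convolutions are.\<close>

lemma fourier_inversion:
  fixes G :: "'p::prime_card mod_ring \<Rightarrow> complex"
  shows "(\<Sum>c\<in>UNIV. additive_char (- (c * n)) * (\<Sum>m\<in>UNIV. G m * additive_char (c * m)))
    = of_nat CARD('p) * G n"
proof -
  have "(\<Sum>c\<in>UNIV. additive_char (- (c * n)) * (\<Sum>m\<in>UNIV. G m * additive_char (c * m)))
      = (\<Sum>c\<in>UNIV. \<Sum>m\<in>UNIV. G m * additive_char ((m - n) * c))"
    unfolding sum_distrib_left
    by (intro sum.cong refl) (simp add: additive_char_add[symmetric] algebra_simps)
  also have "\<dots> = (\<Sum>m\<in>UNIV. G m * (\<Sum>c\<in>UNIV. additive_char ((m - n) * c)))"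
    by (subst sum.swap) (simp add: sum_distrib_left)
  also have "\<dots> = (\<Sum>m\<in>UNIV. if m = n then of_nat CARD('p) * G n else 0)"
    by (intro sum.cong refl) (simp add: sum_additive_char)
  finally show ?thesis by simp
qed

lemma parseval:
  fixes f :: "'p::prime_card mod_ring \<Rightarrow> real"
  shows "(\<Sum>a\<in>UNIV. (cmod (fourier f a))\<^sup>2) = real CARD('p) * (\<Sum>n\<in>UNIV. (f n)\<^sup>2)"
proof -
  have "complex_of_real (\<Sum>a\<in>UNIV. (cmod (fourier f a))\<^sup>2)
      = (\<Sum>a\<in>UNIV. cnj (fourier f a) * fourier f a)"
    unfolding of_real_sum complex_norm_square by (simp add: mult.commute)
  also have "\<dots> = (\<Sum>a\<in>UNIV. \<Sum>n\<in>UNIV. of_real (f n) *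
      (additive_char (- (a * n)) * (\<Sum>m\<in>UNIV. of_real (f m) * additive_char (a * m))))"
    by (intro sum.cong refl)
      (simp add: fourier_eq_sum_additive_char cnj_sum cnj_additive_char sum_distrib_right mult.assoc)
  also have "\<dots> = (\<Sum>n\<in>UNIV. of_real (f n) * (of_nat CARD('p) * of_real (f n)))"
    by (subst sum.swap) (simp add: sum_distrib_left[symmetric] fourier_inversion)
  also have "\<dots> = complex_of_real (real CARD('p) * (\<Sum>n\<in>UNIV. (f n)\<^sup>2))"
    by (simp add: sum_distrib_left power2_eq_square mult_ac)
  finally show ?thesis by (simp only: of_real_eq_iff)
qed

section \<open>Twisted convolutions and a positivity criterion\<close>

lemma conv_power_Suc_Suc: "conv_power (Suc (Suc s)) f = conv f (conv_power (Suc s) f)"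
  by (simp add: conv_power_def)

text \<open>\<open>G\<close> is the convolution of the functions f(n) e(d_i n / p), where e(x) =
  exp(2 pi i x). A twist leaves absolute values unchanged and translates the transform by
  \<open>d i\<close>. The bound on \<open>G\<close> forces it to vanish wherever the convolution
  power does.\<close>

lemma twisted_conv_power:
  fixes f :: "'p::prime_card mod_ring \<Rightarrow> real" and d :: "nat \<Rightarrow> 'p mod_ring"
  assumes "\<And>n. 0 \<le> f n"
  shows "\<exists>G. (\<forall>n. cmod (G n) \<le> conv_power (Suc s) f n) \<and>
    (\<forall>c. (\<Sum>n\<in>UNIV. G n * additive_char (c * n)) = (\<Prod>i\<le>s. fourier f (c + d i)))"
proof (induction s)
  case 0
  show ?case
    using assms
    by (intro exI[of _ "\<lambda>n. of_real (f n) * additive_char (d 0 * n)"])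
      (auto simp: conv_power_def norm_mult fourier_eq_sum_additive_char mult.assoc
        additive_char_add[symmetric] algebra_simps)
next
  case (Suc s)
  then obtain G where G: "\<And>n. cmod (G n) \<le> conv_power (Suc s) f n"
    "\<And>c. (\<Sum>n\<in>UNIV. G n * additive_char (c * n)) = (\<Prod>i\<le>s. fourier f (c + d i))" by blast
  let ?d = "d (Suc s)"
  define G' where "G' n = (\<Sum>m\<in>UNIV. of_real (f m) * additive_char (?d * m) * G (n - m))" for n
  have "cmod (G' n) \<le> conv_power (Suc (Suc s)) f n" for n
    unfolding G'_def conv_power_Suc_Suc conv_def
    by (rule sum_norm_le) (use assms G(1) in \<open>auto simp: norm_mult intro!: mult_left_mono\<close>)
  moreover have "(\<Sum>n\<in>UNIV. G' n * additive_char (c * n)) = (\<Prod>i\<le>Suc s. fourier f (c + d i))" for c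
  proof -
    have "(\<Sum>n\<in>UNIV. G' n * additive_char (c * n))
        = (\<Sum>m\<in>UNIV. \<Sum>n\<in>UNIV. of_real (f m) * additive_char (?d * m) * G (n - m) * additive_char (c * n))"
      unfolding G'_def sum_distrib_right by (rule sum.swap)
    also have "\<dots> = (\<Sum>m\<in>UNIV. \<Sum>n\<in>UNIV. of_real (f m) * additive_char ((c + ?d) * m) *
        (G n * additive_char (c * n)))"
    proof (rule sum.cong[OF refl])
      fix m
      have "(\<Sum>n\<in>UNIV. of_real (f m) * additive_char (?d * m) * G (n - m) * additive_char (c * n))
          = (\<Sum>n\<in>UNIV. of_real (f m) * additive_char (?d * m) * G n * additive_char (c * (n + m)))"
        by (rule sum.reindex_bij_witness[of _ "\<lambda>n. n + m" "\<lambda>n. n - m"]) auto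
      then show "(\<Sum>n\<in>UNIV. of_real (f m) * additive_char (?d * m) * G (n - m) * additive_char (c * n))
          = (\<Sum>n\<in>UNIV. of_real (f m) * additive_char ((c + ?d) * m) * (G n * additive_char (c * n)))"
        by (simp add: distrib_left distrib_right additive_char_add mult_ac)
    qed
    also have "\<dots> = fourier f (c + ?d) * (\<Prod>i\<le>s. fourier f (c + d i))"
      unfolding G(2)[symmetric] unfolding fourier_eq_sum_additive_char sum_product ..
    finally show ?thesis by (simp add: mult.commute)
  qed
  ultimately show ?case by (intro exI[of _ G']) blast
qed

text \<open>Two factors are kept and bounded by the mean of their squares, the others by
  \<open>H\<close>. Summing over all \<open>c\<close> removes the translations from the
  squares.\<close>

lemma sum_prod_translates_le:
  fixes h :: "'p::prime_card mod_ring \<Rightarrow> real" and d :: "'i \<Rightarrow> 'p mod_ring"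
  assumes "finite I" "2 \<le> card I" and h: "\<And>x. 0 \<le> h x" "\<And>x. h x \<le> H"
  shows "(\<Sum>c\<in>UNIV. \<Prod>i\<in>I. h (c + d i)) \<le> H ^ (card I - 2) * (\<Sum>x\<in>UNIV. (h x)\<^sup>2)"
proof -
  have "\<not> card I \<le> Suc 0" using assms(2) by simp
  then obtain u v where uv: "u \<in> I" "v \<in> I" "u \<noteq> v"
    using card_le_Suc0_iff_eq[OF assms(1)] by blast
  have "0 \<le> H" using h[of 0] by linarith
  have shift: "(\<Sum>c\<in>UNIV. (h (c + e))\<^sup>2) = (\<Sum>x\<in>UNIV. (h x)\<^sup>2)" for e
    by (rule sum.reindex_bij_witness[of _ "\<lambda>x. x - e" "\<lambda>x. x + e"]) auto
  have "(\<Prod>i\<in>I. h (c + d i)) \<le> ((h (c + d u))\<^sup>2 + (h (c + d v))\<^sup>2) / 2 * H ^ (card I - 2)" for c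
  proof -
    have "(\<Prod>i\<in>I. h (c + d i)) = h (c + d u) * h (c + d v) * (\<Prod>i\<in>I - {u, v}. h (c + d i))"
    proof -
      have "I = insert u (insert v (I - {u, v}))" using uv by auto
      then have "(\<Prod>i\<in>I. h (c + d i)) = (\<Prod>i\<in>insert u (insert v (I - {u, v})). h (c + d i))" by simp
      also have "\<dots> = h (c + d u) * h (c + d v) * (\<Prod>i\<in>I - {u, v}. h (c + d i))"
        using assms(1) uv by (simp add: mult.assoc)
      finally show ?thesis .
    qed
    also have "\<dots> \<le> ((h (c + d u))\<^sup>2 + (h (c + d v))\<^sup>2) / 2 * H ^ (card I - 2)"
    proof (rule mult_mono)
      show "h (c + d u) * h (c + d v) \<le> ((h (c + d u))\<^sup>2 + (h (c + d v))\<^sup>2) / 2"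
        using sum_squares_bound[of "h (c + d u)" "h (c + d v)"] by simp
      have "(\<Prod>i\<in>I - {u, v}. h (c + d i)) \<le> (\<Prod>i\<in>I - {u, v}. H)"
        using h by (intro prod_mono) auto
      also have "\<dots> = H ^ (card I - 2)"
        using assms(1) uv by (simp add: card_Diff_subset numeral_2_eq_2)
      finally show "(\<Prod>i\<in>I - {u, v}. h (c + d i)) \<le> H ^ (card I - 2)" .
    qed (use h in \<open>auto intro: prod_nonneg\<close>)
    finally show ?thesis .
  qed
  then have "(\<Sum>c\<in>UNIV. \<Prod>i\<in>I. h (c + d i))
      \<le> (\<Sum>c\<in>UNIV. ((h (c + d u))\<^sup>2 + (h (c + d v))\<^sup>2) / 2 * H ^ (card I - 2))"
    by (intro sum_mono)
  also have "\<dots> = H ^ (card I - 2) * (\<Sum>x\<in>UNIV. (h x)\<^sup>2)"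
    by (simp add: sum_distrib_right[symmetric] sum_divide_distrib[symmetric] sum.distrib shift)
  finally show ?thesis .
qed

lemma norm_fourier_le:
  assumes "\<And>n. 0 \<le> f n"
  shows "cmod (fourier f a) \<le> (\<Sum>n\<in>UNIV. f n)"
  unfolding fourier_eq_sum_additive_char
  by (rule sum_norm_le) (use assms in \<open>auto simp: norm_mult\<close>)

text \<open>The unique \<open>c0\<close> gives a term of size at least \<open>M ^ t\<close>; the
  remaining terms total at most the left side of \<open>gap\<close>. Keeping \<open>M\<close> and
  \<open>\<mu>\<close> abstract also admits the full Fourier support as \<open>A\<close>, with
  \<open>\<mu> = 0\<close>.\<close>

lemma conv_power_pos:
  fixes f :: "'p::prime_card mod_ring \<Rightarrow> real" and A :: "'p mod_ring set"
    and d :: "nat \<Rightarrow> 'p mod_ring"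
  assumes range: "\<And>n. 0 \<le> f n \<and> f n \<le> 1"
    and t: "3 \<le> t"
    and unique: "\<And>c. (\<forall>i<t. c + d i \<in> A) \<longleftrightarrow> c = c0"
    and large: "\<And>a. a \<in> A \<Longrightarrow> M \<le> cmod (fourier f a)" and "0 \<le> M"
    and tiny: "\<And>a. a \<notin> A \<Longrightarrow> cmod (fourier f a) \<le> \<mu>" and "0 \<le> \<mu>"
    and gap: "real t * \<mu> * (density f ^ (t - 2) * real CARD('p) ^ (t - 1)) < M ^ t"
  shows "0 < conv_power t f n"
proof (rule ccontr)
  assume nonpos: "\<not> ?thesis"
  obtain s where s: "t = Suc s" using t by (cases t) auto
  obtain G where G: "\<And>n. cmod (G n) \<le> conv_power t f n"
    "\<And>c. (\<Sum>n\<in>UNIV. G n * additive_char (c * n)) = (\<Prod>i<t. fourier f (c + d i))"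
    using twisted_conv_power[of f s d] range unfolding s lessThan_Suc_atMost by blast
  have "cmod (G n) \<le> 0" using G(1)[of n] nonpos by linarith
  then have "G n = 0" by simp
  then have zero: "(\<Sum>c\<in>UNIV. additive_char (- (c * n)) * (\<Prod>i<t. fourier f (c + d i))) = 0"
    using fourier_inversion[of n G] unfolding G(2) by simp
  define h where "h a = cmod (fourier f a)" for a
  have h0: "0 \<le> h a" for a by (simp add: h_def)
  define H where "H = (\<Sum>n\<in>UNIV. f n)"
  have H: "H = density f * real CARD('p)" by (simp add: H_def density_def)
  have hH: "h a \<le> H" for a unfolding h_def H_def using range by (intro norm_fourier_le) auto
  have "0 \<le> H" using hH[of 0] h0[of 0] by linarith
  have "(\<Sum>a\<in>UNIV. (h a)\<^sup>2) = real CARD('p) * (\<Sum>n\<in>UNIV. (f n)\<^sup>2)"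
    unfolding h_def by (rule parseval)
  \<comment> \<open>Since \<open>f\<close> takes values in [0, 1], its square is at most
    \<open>f\<close>.\<close>
  also have "\<dots> \<le> real CARD('p) * H"
    unfolding H_def using range
    by (intro mult_left_mono sum_mono) (auto simp: power2_eq_square intro: mult_left_le)
  finally have l2: "(\<Sum>a\<in>UNIV. (h a)\<^sup>2) \<le> real CARD('p) * H" .
  have part: "(\<Sum>c\<in>UNIV. \<Prod>j\<in>{..<t} - {i}. h (c + d j)) \<le> H ^ (t - 3) * (real CARD('p) * H)"
    if "i < t" for i
  proof -
    have "card ({..<t} - {i}) = t - 1" using that by simp
    then have "(\<Sum>c\<in>UNIV. \<Prod>j\<in>{..<t} - {i}. h (c + d j)) \<le> H ^ (t - 1 - 2) * (\<Sum>a\<in>UNIV. (h a)\<^sup>2)"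
      using sum_prod_translates_le[of "{..<t} - {i}" h H d] h0 hH t by simp
    also have "\<dots> \<le> H ^ (t - 3) * (real CARD('p) * H)"
      using l2 \<open>0 \<le> H\<close> by (auto simp: numeral_3_eq_3 intro: mult_left_mono)
    finally show ?thesis .
  qed
  \<comment> \<open>The index whose translate leaves \<open>A\<close> depends on \<open>c\<close>;
    summing over all indices makes the bound uniform and produces the factor \<open>t\<close> in
    \<open>gap\<close>.\<close>
  have bound: "(\<Prod>i<t. h (c + d i)) \<le> (\<Sum>i<t. \<mu> * (\<Prod>j\<in>{..<t} - {i}. h (c + d j)))" if ne: "c \<noteq> c0" for c
  proof -
    obtain i where i: "i < t" "c + d i \<notin> A" using unique ne by blast
    have "(\<Prod>i<t. h (c + d i)) = h (c + d i) * (\<Prod>j\<in>{..<t} - {i}. h (c + d j))"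
      using i(1) by (intro prod.remove) auto
    also have "\<dots> \<le> \<mu> * (\<Prod>j\<in>{..<t} - {i}. h (c + d j))"
      using tiny[OF i(2)] h0 by (intro mult_right_mono prod_nonneg) (auto simp: h_def)
    also have "\<dots> \<le> (\<Sum>i<t. \<mu> * (\<Prod>j\<in>{..<t} - {i}. h (c + d j)))"
      using i(1) h0 \<open>0 \<le> \<mu>\<close>
      by (intro member_le_sum) (auto intro!: mult_nonneg_nonneg prod_nonneg)
    finally show ?thesis .
  qed
  have "M ^ t = (\<Prod>i<t. M)" by simp
  also have "\<dots> \<le> (\<Prod>i<t. h (c0 + d i))"
    using large unique[of c0] \<open>0 \<le> M\<close> by (intro prod_mono) (auto simp: h_def)
  also have "\<dots> = cmod (additive_char (- (c0 * n)) * (\<Prod>i<t. fourier f (c0 + d i)))"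
    by (simp add: norm_mult prod_norm h_def)
  also have "additive_char (- (c0 * n)) * (\<Prod>i<t. fourier f (c0 + d i))
      = - (\<Sum>c\<in>UNIV - {c0}. additive_char (- (c * n)) * (\<Prod>i<t. fourier f (c + d i)))"
    using zero by (subst (asm) sum.remove[of _ c0]) (auto simp: eq_neg_iff_add_eq_0)
  also have "cmod \<dots> \<le> (\<Sum>c\<in>UNIV - {c0}. \<Prod>i<t. h (c + d i))"
    unfolding norm_minus_cancel by (rule sum_norm_le) (simp add: norm_mult prod_norm h_def)
  also have "\<dots> \<le> (\<Sum>c\<in>UNIV - {c0}. \<Sum>i<t. \<mu> * (\<Prod>j\<in>{..<t} - {i}. h (c + d j)))"
    using bound by (intro sum_mono) auto
  also have "\<dots> \<le> (\<Sum>c\<in>UNIV. \<Sum>i<t. \<mu> * (\<Prod>j\<in>{..<t} - {i}. h (c + d j)))"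
    using h0 \<open>0 \<le> \<mu>\<close> by (intro sum_mono2 sum_nonneg) (auto intro!: mult_nonneg_nonneg prod_nonneg)
  also have "\<dots> = (\<Sum>i<t. \<mu> * (\<Sum>c\<in>UNIV. \<Prod>j\<in>{..<t} - {i}. h (c + d j)))"
    unfolding sum_distrib_left by (rule sum.swap)
  also have "\<dots> \<le> (\<Sum>i<t. \<mu> * (H ^ (t - 3) * (real CARD('p) * H)))"
    using part \<open>0 \<le> \<mu>\<close> by (intro sum_mono mult_left_mono) auto
  also have "\<dots> = real t * \<mu> * (density f ^ (t - 2) * real CARD('p) ^ (t - 1))"
  proof -
    obtain q where q: "t = q + 3" using t by (metis add.commute le_Suc_ex)
    show ?thesis unfolding q H by (simp add: power_mult_distrib eval_nat_numeral mult_ac)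
  qed
  also have "\<dots> < M ^ t" by (rule gap)
  finally show False by simp
qed

section \<open>Estimates for iterated logarithms\<close>

text \<open>The bound on \<open>k\<close> sees only even powers of ln ln p, so primes with a
  negative or small ln ln p have to be excluded separately. The 225 is (5 * 3)^2, from t at least
  3.\<close>

lemma ln_ln_ge_half:
  fixes p :: nat
  assumes "2 \<le> p" and big: "225 * (ln (ln (real p)))\<^sup>2 < ln (real p)"
  shows "1 / 2 \<le> ln (ln (real p))"
proof (rule ccontr)
  define L where "L = ln (ln (real p))"
  assume "\<not> ?thesis"
  then have L: "L < 1 / 2" by (simp add: L_def)
  have lnp: "0 < ln (real p)" using assms(1) by simp
  then have exp_L: "exp L = ln (real p)" by (simp add: L_def)
  consider "p = 2" | "3 \<le> p" using assms(1) by linarith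
  then show False
  proof cases
    case 1
    have "L \<le> ln (25 / 36)" using ln2_le_25_over_36 1 by (simp add: L_def)
    also have "\<dots> \<le> 25 / 36 - 1" by (rule ln_le_minus_one) simp
    finally have "(11 / 36)\<^sup>2 \<le> (- L)\<^sup>2" by (intro power_mono) auto
    then show False using big ln2_le_25_over_36 1 by (simp add: L_def power2_eq_square)
  next
    case 2
    \<comment> \<open>This gives \<open>L\<close> at least 2 / 27. Then 225 L^2 < exp L, which is at
      most 1 + L + L^2, is impossible: it would yield (224 * 2 / 27) L < 1 + L.\<close>
    have "27 / 25 \<le> ln (3::real)"
      using ln_approx_bounds[of 3 2] by (simp add: eval_nat_numeral)
    also have "\<dots> \<le> ln (real p)" using 2 by simp
    finally have "ln (27 / 25) \<le> L" unfolding L_def using lnp by simp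
    moreover have "ln (25 / 27 :: real) \<le> 25 / 27 - 1" by (rule ln_le_minus_one) simp
    ultimately have L0: "2 / 27 \<le> L" using ln_inverse[of "27 / 25 :: real"] by simp
    have "exp L \<le> 1 + L + L\<^sup>2" using L L0 by (intro exp_bound) auto
    moreover have "2 / 27 * L \<le> L\<^sup>2" using L0 unfolding power2_eq_square by (intro mult_right_mono) auto
    moreover have "225 * L\<^sup>2 < exp L" using big exp_L by (simp add: L_def)
    ultimately show False using L0 by linarith
  qed
qed

text \<open>Here ln k is at most \<open>x = (t - 1) * L\<close>, so \<open>m\<close> is at most 7 R
  x and ln (2 k) at most 2 x. Their product is at most 14 R (t L)^2, which is 14 / 25 of ln p: the 5
  in the bound on \<open>k\<close> makes room for the 14.\<close>

lemma power_bound_of_ln_bound: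
  fixes p k m s t :: nat and L R :: real
  assumes "2 \<le> p" and t: "3 \<le> t" and L: "L = ln (ln (real p))" "1 / 2 \<le> L"
    and R: "R = ln (real p) / (5 * real t * L)\<^sup>2" "1 \<le> R"
    and k: "1 \<le> k" "real k < R ^ (t - 1)"
    and m: "real m \<le> 6 * R * ln (real k) + 1"
  shows "(2 * k) ^ m < p"
proof -
  define x where "x = real (t - 1) * L"
  have lnp: "0 < ln (real p)" using assms(1) by simp
  have exp_L: "exp L = ln (real p)" using lnp L(1) by simp
  have "2 * (1 / 2) \<le> x" unfolding x_def using t L(2) by (intro mult_mono) auto
  then have x: "1 \<le> x" by simp
  have tL: "15 / 2 \<le> 5 * real t * L"
    using mult_mono[of 15 "5 * real t" "1 / 2" L] t L(2) by simp
  then have "1 \<le> (5 * real t * L)\<^sup>2" by (intro one_le_power) linarith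
  then have "R \<le> ln (real p)" unfolding R(1) using lnp by (simp add: divide_le_eq mult_left_le)
  then have "real k < exp L ^ (t - 1)"
    using k(2) R(2) power_mono[of R "ln (real p)" "t - 1"] exp_L by simp
  also have "\<dots> = exp x" unfolding x_def by (simp add: exp_of_nat_mult)
  finally have "ln (real k) < ln (exp x)" using k(1) by (intro ln_less_cancel_iff[THEN iffD2]) auto
  then have lnk: "ln (real k) \<le> x" by simp
  have "6 * R * ln (real k) \<le> 6 * R * x" using lnk R(2) by (intro mult_left_mono) auto
  then have "real m \<le> 6 * R * x + 1" using m by linarith
  \<comment> \<open>This absorbs the additive 1 in the bound on \<open>m\<close>, turning 6 into
    7.\<close>
  moreover have "1 * 1 \<le> R * x" using R(2) x by (intro mult_mono) auto
  ultimately have m7: "real m \<le> 7 * (R * x)" by simp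
  have "ln (real (2 * k)) = ln 2 + ln (real k)" using k(1) by (simp add: ln_mult)
  also have "\<dots> \<le> 2 * x" using lnk x ln_2_less_1 by simp
  finally have "real m * ln (real (2 * k)) \<le> 7 * (R * x) * (2 * x)"
    using m7 k(1) R(2) x by (intro mult_mono) auto
  also have "\<dots> = 14 * R * x\<^sup>2" by (simp add: power2_eq_square)
  also have "\<dots> \<le> 14 * R * (real t * L)\<^sup>2"
    unfolding x_def using R(2) L(2) by (intro mult_left_mono power_mono mult_right_mono) auto
  also have "\<dots> = 14 / 25 * ln (real p)"
    unfolding R(1) using t L(2) by (simp add: power_mult_distrib field_simps)
  also have "\<dots> < ln (real p)" using lnp by simp
  finally have "ln (real ((2 * k) ^ m)) < ln (real p)"
    using k(1) ln_realpow[of "real (2 * k)" m] by (simp only: of_nat_power)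
  moreover have "0 < real ((2 * k) ^ m)" "0 < real p" using k(1) assms(1) by auto
  ultimately have "real ((2 * k) ^ m) < real p" using ln_less_cancel_iff by blast
  then show ?thesis by (simp only: of_nat_less_iff)
qed

section \<open>Positivity from a gap in the spectrum\<close>

theorem theorem2:
  fixes f :: "'p::prime_card mod_ring \<Rightarrow> real"
    and p t k :: nat
    and a :: "nat \<Rightarrow> 'p mod_ring"
    and lam :: "nat \<Rightarrow> complex"
    and theta gamma :: real
  assumes p: "p = CARD('p)"
    and range: "\<And>n. 0 \<le> f n \<and> f n \<le> 1"
    and nonzero: "\<exists>n. f n \<noteq> 0"
    and theta: "theta = density f"
    and enum: "bij_betw a {1..p} UNIV"
    and lam: "\<And>i. lam i = fourier f (a i)"
    and decreasing: "\<And>i j. 1 \<le> i \<Longrightarrow> i \<le> j \<Longrightarrow> j \<le> p \<Longrightarrow> cmod (lam j) \<le> cmod (lam i)"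
    and t: "3 \<le> t"
    and k_pos: "1 \<le> k"
    and k_less: "real k < ln (real p) ^ (t - 1) *
                   (5 * real t * ln (ln (real p))) powi (- 2 * int t + 2)"
    and gap: "cmod (lam (k + 1)) \<le> gamma * cmod (lam k)"
    and gamma: "gamma < inverse (real t) * theta powi (- int t + 2) *
                  (cmod (lam k) / real p) ^ (t - 1)"
  shows "\<forall>n. 0 < conv_power t f n"
proof
  fix n
  define L where "L = ln (ln (real p))"
  define R where "R = ln (real p) / (5 * real t * L)\<^sup>2"
  have p2: "2 \<le> p" using p prime_card[where ?'a = 'p] prime_ge_2_nat by blast
  have lnp: "0 < ln (real p)" using p2 by simp
  have R0: "0 \<le> R" using lnp unfolding R_def by simp
  have kR: "real k < R ^ (t - 1)"
  proof -
    have "- 2 * int t + 2 = - int (2 * (t - 1))" using t by simp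
    then have "(5 * real t * L) powi (- 2 * int t + 2) = inverse ((5 * real t * L) ^ (2 * (t - 1)))"
      by (simp only: power_int_minus power_int_of_nat)
    then show ?thesis using k_less unfolding R_def L_def
      by (simp add: power_mult divide_inverse power_mult_distrib[of "ln (real p)"] power_inverse)
  qed
  have "1 < R"
  proof (rule ccontr)
    assume "\<not> 1 < R"
    then have "R ^ (t - 1) \<le> 1" using R0 by (intro power_le_one) auto
    then show False using kR k_pos by simp
  qed
  \<comment> \<open>Division by zero gives 0, so \<open>L = 0\<close> would make \<open>R\<close>
    equal to 0.\<close>
  then have "L \<noteq> 0" unfolding R_def by auto
  then have "(5 * real t * L)\<^sup>2 < ln (real p)"
    using \<open>1 < R\<close> t unfolding R_def by (simp add: less_divide_eq)
  moreover have "225 * L\<^sup>2 \<le> (5 * real t * L)\<^sup>2"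
    using power_mono[of 15 "5 * real t" 2] t by (simp add: power_mult_distrib mult_right_mono)
  ultimately have L: "1 / 2 \<le> L" unfolding L_def using p2 by (intro ln_ln_ge_half) auto
  have small: "(2 * k) ^ m < CARD('p)" if "real m \<le> 6 * R * ln (real k) + 1" for m
    using power_bound_of_ln_bound[OF p2 t L_def L R_def _ k_pos kR that] \<open>1 < R\<close> p by simp
  \<comment> \<open>The case \<open>m = 1\<close> gives 2 k < p. The ordering hypothesis says
    nothing about indices beyond p.\<close>
  have "k < p"
  proof -
    have "0 \<le> 6 * R * ln (real k)" using R0 k_pos by simp
    then show ?thesis using small[of 1] p by simp
  qed
  have theta0: "0 < theta"
  proof -
    obtain n0 where "f n0 \<noteq> 0" using nonzero by blast
    then have "0 < (\<Sum>n\<in>UNIV. f n)"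
      using range by (intro sum_pos2[of _ n0]) (auto simp: less_le)
    then show ?thesis unfolding theta density_def by simp
  qed
  \<comment> \<open>The \<open>t\<close> shifts have indices 0 to \<open>t - 1\<close>, so the
    intersection argument runs with \<open>s = t - 1\<close>, the exponent in the bound on
    \<open>k\<close>.\<close>
  have positive: "0 < conv_power t f n"
    if A: "A \<noteq> {}" "card A \<le> k" "\<And>x. x \<in> A \<Longrightarrow> M \<le> cmod (fourier f x)" "0 \<le> M"
      "\<And>x. x \<notin> A \<Longrightarrow> cmod (fourier f x) \<le> \<mu>" "0 \<le> \<mu>"
      "real t * \<mu> * (theta ^ (t - 2) * real p ^ (t - 1)) < M ^ t" for A M \<mu>
  proof -
    obtain d c0 where d: "\<And>c. (\<forall>i\<le>t - 1. c + d i \<in> A) \<longleftrightarrow> c = c0"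
      using unique_translate_inter[OF A(1,2) _ small kR] \<open>1 < R\<close> by force
    have "i \<le> t - 1 \<longleftrightarrow> i < t" for i using t by auto
    then show ?thesis
      using conv_power_pos[of f t d A c0 M \<mu> n] range t d A unfolding theta p by simp
  qed
  show "0 < conv_power t f n"
  proof (cases "lam k = 0")
    \<comment> \<open>The hypotheses then hold with any negative gamma, but f has fewer than k nonzero
      Fourier coefficients, so their support serves as the set of frequencies.\<close>
    case True
    define A where "A = {x. fourier f x \<noteq> 0}"
    define M where "M = Min ((\<lambda>x. cmod (fourier f x)) ` A)"
    have "A \<subseteq> a ` {1..k}"
    proof
      fix x assume x: "x \<in> A"
      obtain i where i: "i \<in> {1..p}" "x = a i" using enum by (metis UNIV_I bij_betw_imp_surj_on imageE)
      have "\<not> k \<le> i" using decreasing[OF k_pos, of i] i x True unfolding A_def lam by auto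
      then show "x \<in> a ` {1..k}" using i by auto
    qed
    then have "card A \<le> k"
      by (metis card_atLeastAtMost card_image_le card_mono diff_Suc_1 finite_atLeastAtMost finite_imageI le_trans)
    \<comment> \<open>Frequency 0 carries the total mass of \<open>f\<close>, so the support is
      nonempty and its minimum \<open>M\<close> is positive.\<close>
    moreover have "fourier f 0 = of_real (theta * real p)"
      unfolding theta p density_def fourier_eq_sum_additive_char by simp
    then have "0 \<in> A" using theta0 p2 unfolding A_def by simp
    then have "A \<noteq> {}" by blast
    moreover from this have "0 < M" unfolding M_def by (auto simp: A_def)
    ultimately show ?thesis by (intro positive[of A M 0]) (auto simp: M_def A_def)
  next
    case False
    define M where "M = cmod (lam k)"
    define \<mu> where "\<mu> = cmod (lam (k + 1))"
    have "0 < M" using False unfolding M_def by simp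
    have "card (a ` {1..k}) \<le> k" using card_image_le[of "{1..k}" a] by simp
    moreover have "M \<le> cmod (fourier f x)" if "x \<in> a ` {1..k}" for x
      using that decreasing \<open>k < p\<close> unfolding M_def lam by auto
    moreover have "cmod (fourier f x) \<le> \<mu>" if x: "x \<notin> a ` {1..k}" for x
    proof -
      obtain i where i: "i \<in> {1..p}" "x = a i" using enum by (metis UNIV_I bij_betw_imp_surj_on imageE)
      then have "k + 1 \<le> i" using x by auto
      then show ?thesis using decreasing[of "k + 1" i] i unfolding \<mu>_def lam by simp
    qed
    \<comment> \<open>The bound on \<open>gamma\<close>, multiplied by the positive \<open>M\<close>
      and cleared of denominators.\<close>
    moreover have "real t * \<mu> * (theta ^ (t - 2) * real p ^ (t - 1)) < M ^ t"
    proof -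
      let ?T = "theta ^ (t - 2)" and ?P = "real p ^ (t - 1)"
      have T: "0 < ?T" "0 < ?P" using theta0 p2 by simp_all
      have "- int t + 2 = - int (t - 2)" using t by simp
      then have "theta powi (- int t + 2) = inverse ?T"
        by (simp only: power_int_minus power_int_of_nat)
      then have "gamma < M ^ (t - 1) / (real t * ?T * ?P)"
        using gamma unfolding M_def by (simp add: divide_inverse power_mult_distrib power_inverse mult_ac)
      then have "gamma * M < M ^ (t - 1) / (real t * ?T * ?P) * M"
        using \<open>0 < M\<close> by (rule mult_strict_right_mono)
      then have "\<mu> < M ^ (t - 1) * M / (real t * ?T * ?P)"
        using gap unfolding \<mu>_def M_def by simp
      also have "M ^ (t - 1) * M = M ^ t" using t by (simp add: power_eq_if)
      finally show ?thesis using T t by (simp add: pos_less_divide_eq mult_ac)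
    qed
    ultimately show ?thesis
      using k_pos \<open>0 < M\<close> by (intro positive[of "a ` {1..k}" M \<mu>]) (auto simp: \<mu>_def)
  qed
qed

end
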